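(* Let $0<a<1$ be fixed. There does not exist any $t>0$ with the following property: for every $f\in L^2(\mathbb{R}^n)$ satisfying $$K_a(f) = \int_{\mathbb{R}^n}\int_{\mathbb{R}^n} |f(x)|\,|\hat f(y)|\, e^{a|x\cdot y|}\,dx\,dy < \infty$$ there is a constant $C_{f,t}$ such that $|(f,\Phi_\alpha)| \leq C_{f,t}\, e^{-(2|\alpha|+n)t/2}$ for all $\alpha\in\mathbb{N}^n$.
   Context: The Fourier transform is $\hat f(y) = (2\pi)^{-n/2}\int_{\mathbb{R}^n} f(x) e^{-i x\cdot y}\,dx$, extended to $L^2(\mathbb{R}^n)$ as usual. $\mathbb{N}=\{0,1,2,\ldots\}$ and $|\alpha|=\alpha_1+\cdots+\alpha_n$ for $\alpha\in\mathbb{N}^n$. $\Phi_\alpha$ are the normalised Hermite functions on $\mathbb{R}^n$: $\Phi_\alpha(x)=\prod_{j=1}^n h_{\alpha_j}(x_j)$, where $h_k(s) = (2^k k!\sqrt{\pi})^{-1/2} H_k(s) e^{-s^2/2}$ and $H_k(s) = (-1)^k e^{s^2}\frac{d^k}{ds^k}e^{-s^2}$; they form an orthonormal basis of $L^2(\mathbb{R}^n)$. $(f,\Phi_\alpha)=\int_{\mathbb{R}^n} f(x)\Phi_\alpha(x)\,dx$ are the Hermite coefficients of $f$. *)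

theory Defs
  imports "HOL-Analysis.Analysis"
begin

text \<open>Elements of $L^2(R^n)$ are rendered by Borel measurable representatives;
  every almost-everywhere class of Lebesgue measurable functions contains one.\<close>

definition L2 :: "(real ^ 'n \<Rightarrow> complex) set" where
  "L2 = {f. f \<in> borel_measurable lborel \<and> integrable lborel (\<lambda>x. (norm (f x))\<^sup>2)}"

definition L2_tendsto ::
    "(nat \<Rightarrow> real ^ 'n \<Rightarrow> complex) \<Rightarrow> (real ^ 'n \<Rightarrow> complex) \<Rightarrow> bool" where
  "L2_tendsto F f \<longleftrightarrow>
     (\<lambda>k. \<integral>\<^sup>+ x. ennreal ((norm (F k x - f x))\<^sup>2) \<partial>lborel) \<longlonglongrightarrow> 0"

text \<open>Meaningful for integrable functions only.\<close>

definition fourier_L1 :: "(real ^ 'n \<Rightarrow> complex) \<Rightarrow> real ^ 'n \<Rightarrow> complex" where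
  "fourier_L1 f y =
     complex_of_real ((2 * pi) powr (- (real CARD('n) / 2))) *
     (LINT x|lborel. f x * exp (- (\<i> * complex_of_real (x \<bullet> y))))"

text \<open>The extension to $L^2$ by density and continuity: \<open>g\<close> is a representative of the
  Fourier transform of \<open>f\<close> if \<open>(f, g)\<close> is the limit in $L^2 \times L^2$ of pairs formed by
  a function in $L^1 \cap L^2$ and its transform. It is a relation because the transform of
  an $L^2$ function is only determined almost everywhere; by Plancherel's theorem every
  \<open>f\<close> in $L^2$ has such a \<open>g\<close>, unique up to a null set.\<close>

definition is_fourier_L2 :: "(real ^ 'n \<Rightarrow> complex) \<Rightarrow> (real ^ 'n \<Rightarrow> complex) \<Rightarrow> bool" where
  "is_fourier_L2 f g \<longleftrightarrow> f \<in> L2 \<and> g \<in> L2 \<and>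
     (\<exists>F. (\<forall>k. integrable lborel (F k) \<and> F k \<in> L2) \<and>
          L2_tendsto F f \<and> L2_tendsto (\<lambda>k. fourier_L1 (F k)) g)"

text \<open>The argument \<open>g\<close> stands for a representative of the Fourier transform of \<open>f\<close>;
  the value does not depend on the choice.\<close>

definition beurling_integral ::
    "real \<Rightarrow> (real ^ 'n \<Rightarrow> complex) \<Rightarrow> (real ^ 'n \<Rightarrow> complex) \<Rightarrow> ennreal" where
  "beurling_integral a f g =
     (\<integral>\<^sup>+ x. (\<integral>\<^sup>+ y. ennreal (norm (f x) * norm (g y) * exp (a * \<bar>x \<bullet> y\<bar>)) \<partial>lborel) \<partial>lborel)"

definition hermite_poly :: "nat \<Rightarrow> real \<Rightarrow> real" where
  "hermite_poly k s = (-1) ^ k * exp (s\<^sup>2) * (deriv ^^ k) (\<lambda>u. exp (- (u\<^sup>2))) s"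

definition hermite_fun :: "nat \<Rightarrow> real \<Rightarrow> real" where
  "hermite_fun k s =
     (2 ^ k * fact k * sqrt pi) powr (- 1 / 2) * hermite_poly k s * exp (- (s\<^sup>2) / 2)"

definition Hermite_Phi :: "('n::finite \<Rightarrow> nat) \<Rightarrow> real ^ 'n \<Rightarrow> real" where
  "Hermite_Phi \<alpha> x = (\<Prod>j\<in>UNIV. hermite_fun (\<alpha> j) (x $ j))"

definition hermite_coeff :: "(real ^ 'n \<Rightarrow> complex) \<Rightarrow> ('n::finite \<Rightarrow> nat) \<Rightarrow> complex" where
  "hermite_coeff f \<alpha> = (LINT x|lborel. f x * complex_of_real (Hermite_Phi \<alpha> x))"

definition multi_deg :: "('n::finite \<Rightarrow> nat) \<Rightarrow> nat" where
  "multi_deg \<alpha> = (\<Sum>j\<in>UNIV. \<alpha> j)"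

end

theory Submission
  imports Defs "HOL-Probability.Characteristic_Functions"  "HOL-Real_Asymp.Real_Asymp"
begin

text \<open>
  The Gaussians \<open>f(x) = exp (- \<nu> |x|\<^sup>2 / 2)\<close> are counterexamples for every \<open>t\<close>: the exponential
  weight of \<open>K\<^sub>a\<close> is invariant under the dilation \<open>(x, y) \<mapsto> (c x, y / c)\<close>, whereas the Hermite
  basis is tied to one scale. The transform of \<open>f\<close> is a multiple of \<open>exp (- |y|\<^sup>2 / (2 \<nu>))\<close>, and
  \<open>|x \<bullet> y| \<le> (\<nu> |x|\<^sup>2 + |y|\<^sup>2 / \<nu>) / 2\<close>, so for \<open>a < 1\<close> the factor \<open>exp (a |x \<bullet> y|)\<close> uses up only a
  fraction \<open>a\<close> of the Gaussian decay. Hence \<open>K\<^sub>a(f)\<close> is finite no matter how small \<open>\<nu> > 0\<close> is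
  (\<open>beurling_integral_gaussian_finite\<close>).

  The Hermite coefficients of \<open>f\<close> are products of one-dimensional ones. Integration by parts
  against \<open>exp (- (1 + \<nu>) s\<^sup>2 / 2)\<close> together with \<open>H\<^sub>k\<^sub>+\<^sub>1 = 2 s H\<^sub>k - H\<^sub>k'\<close> and
  \<open>H\<^sub>k\<^sub>+\<^sub>1' = 2 (k + 1) H\<^sub>k\<close> gives a two-step recursion for the integrals, hence a closed form
  (\<open>gaussian_hermite_coeff_sq\<close>): up to a power of \<open>k\<close>, the coefficient of index \<open>2 k\<close> has the
  size \<open>r ^ k\<close> with \<open>r = (1 - \<nu>) / (1 + \<nu>)\<close>. The decay rate claimed for \<open>t\<close> would force it to be
  \<open>O(exp (- 2 k t))\<close>. Since \<open>r\<close> tends to 1 as \<open>\<nu>\<close> tends to 0, choosing \<open>\<nu>\<close> with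
  \<open>r = exp (- t)\<close> refutes it.
\<close>

section \<open>Gaussian integrals on the line\<close>

lemma gaussian_eq_normal_density:
  fixes \<mu> s :: real
  assumes "\<mu> > 0"
  shows "exp (- (\<mu> * s\<^sup>2 / 2)) = sqrt (2 * pi / \<mu>) * normal_density 0 (1 / sqrt \<mu>) s"
  using assms by (simp add: normal_density_def real_sqrt_divide real_sqrt_mult power_divide field_simps)

lemma integrable_monomial_gaussian:
  fixes \<mu> :: real
  assumes "\<mu> > 0"
  shows "integrable lborel (\<lambda>s. s ^ m * exp (- (\<mu> * s\<^sup>2 / 2)))"
proof -
  have "integrable lborel (\<lambda>s. sqrt (2 * pi / \<mu>) * (normal_density 0 (1 / sqrt \<mu>) s * (s - 0) ^ m))"
    using assms by (intro integrable_mult_right integrable_normal_moment) simp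
  then show ?thesis
    using assms by (simp add: gaussian_eq_normal_density mult_ac)
qed

lemma gaussian_moment:
  fixes \<mu> :: real
  assumes "\<mu> > 0"
  shows "(LINT s|lborel. s ^ m * exp (- (\<mu> * s\<^sup>2 / 2))) =
    (if even m then sqrt (2 * pi / \<mu>) * fact m / ((2 * \<mu>) ^ (m div 2) * fact (m div 2)) else 0)"
proof -
  have pos: "1 / sqrt \<mu> > 0" using assms by simp
  have eq: "(LINT s|lborel. s ^ m * exp (- (\<mu> * s\<^sup>2 / 2))) =
      sqrt (2 * pi / \<mu>) * (LINT s|lborel. normal_density 0 (1 / sqrt \<mu>) s * (s - 0) ^ m)"
    using assms by (simp add: gaussian_eq_normal_density mult_ac flip: integral_mult_right_zero)
  show ?thesis
  proof (cases "even m")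
    case True
    then obtain k where "m = 2 * k" by (elim evenE)
    then show ?thesis
      unfolding eq using integral_normal_moment_even[OF pos, of 0 k] assms
      by (simp add: power_divide)
  next
    case False
    then obtain k where "m = 2 * k + 1" by (elim oddE)
    then show ?thesis
      unfolding eq using integral_normal_moment_odd[OF pos, of 0 k] assms by simp
  qed
qed

lemma integrable_poly_gaussian:
  fixes \<mu> :: real
  assumes "\<mu> > 0"
  shows "integrable lborel (\<lambda>s. poly P s * exp (- (\<mu> * s\<^sup>2 / 2)))"
  unfolding poly_altdef sum_distrib_right mult.assoc
  by (intro Bochner_Integration.integrable_sum integrable_mult_right
        integrable_monomial_gaussian assms)

lemma gaussian_moment_step:
  fixes \<mu> :: real
  assumes "\<mu> > 0"
  shows "\<mu> * (LINT s|lborel. s ^ Suc m * exp (- (\<mu> * s\<^sup>2 / 2))) =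
    real m * (LINT s|lborel. s ^ (m - 1) * exp (- (\<mu> * s\<^sup>2 / 2)))"
proof (cases "even m")
  case True
  then show ?thesis
    using gaussian_moment[OF assms, of "Suc m"] gaussian_moment[OF assms, of "m - 1"]
    by (cases "m = 0") (simp_all del: power_Suc)
next
  case False
  then obtain k where k: "m = 2 * k + 1" by (elim oddE)
  have "(LINT s|lborel. s ^ Suc m * exp (- (\<mu> * s\<^sup>2 / 2)))
      = sqrt (2 * pi / \<mu>) * (fact (2 * Suc k) / ((2 * \<mu>) ^ Suc k * fact (Suc k)))"
    using gaussian_moment[OF assms, of "2 * Suc k"] by (simp add: k)
  moreover have "(LINT s|lborel. s ^ (m - 1) * exp (- (\<mu> * s\<^sup>2 / 2)))
      = sqrt (2 * pi / \<mu>) * (fact (2 * k) / ((2 * \<mu>) ^ k * fact k))"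
    using gaussian_moment[OF assms, of "2 * k"] by (simp add: k)
  moreover have "\<mu> * (fact (2 * Suc k) / ((2 * \<mu>) ^ Suc k * fact (Suc k)))
      = real m * (fact (2 * k) / ((2 * \<mu>) ^ k * fact k))"
    using assms by (simp add: k divide_simps)
  ultimately show ?thesis
    by (simp only: mult.left_commute[of _ "sqrt (2 * pi / \<mu>)"])
qed

text \<open>On monomials this is the two-step recursion of the Gaussian moments, so no boundary
  terms need to be estimated; the general case follows by linearity.\<close>

lemma gaussian_integration_by_parts:
  fixes \<mu> :: real
  assumes "\<mu> > 0"
  shows "\<mu> * (LINT s|lborel. s * poly P s * exp (- (\<mu> * s\<^sup>2 / 2))) =
    (LINT s|lborel. poly (pderiv P) s * exp (- (\<mu> * s\<^sup>2 / 2)))"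
proof -
  let ?w = "\<lambda>s. exp (- (\<mu> * s\<^sup>2 / 2))"
  note int = integrable_monomial_gaussian[OF assms]
  have der: "poly (pderiv P) s = (\<Sum>i\<le>degree P. coeff P i * (real i * s ^ (i - 1)))" for s
  proof (rule DERIV_unique[OF poly_DERIV])
    show "(poly P has_real_derivative (\<Sum>i\<le>degree P. coeff P i * (real i * s ^ (i - 1)))) (at s)"
      unfolding poly_altdef by (auto intro!: derivative_eq_intros sum.cong)
  qed
  have "\<mu> * (LINT s|lborel. s * poly P s * ?w s)
      = \<mu> * (LINT s|lborel. (\<Sum>i\<le>degree P. coeff P i * (s ^ Suc i * ?w s)))"
    by (simp add: poly_altdef sum_distrib_left sum_distrib_right mult_ac)
  also have "\<dots> = (\<Sum>i\<le>degree P. coeff P i * (\<mu> * (LINT s|lborel. s ^ Suc i * ?w s)))"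
    by (subst Bochner_Integration.integral_sum)
       (use int in \<open>auto simp: sum_distrib_left mult_ac simp del: power_Suc\<close>)
  also have "\<dots> = (\<Sum>i\<le>degree P. coeff P i * (real i * (LINT s|lborel. s ^ (i - 1) * ?w s)))"
    by (simp only: gaussian_moment_step[OF assms])
  also have "\<dots> = (LINT s|lborel. (\<Sum>i\<le>degree P. coeff P i * (real i * (s ^ (i - 1) * ?w s))))"
    by (subst Bochner_Integration.integral_sum) (use int in auto)
  also have "\<dots> = (LINT s|lborel. poly (pderiv P) s * ?w s)"
    by (simp add: der sum_distrib_left sum_distrib_right mult_ac)
  finally show ?thesis .
qed

section \<open>Hermite polynomials against a Gaussian\<close>

fun hermite_polynomial :: "nat \<Rightarrow> real poly" where
  "hermite_polynomial 0 = 1"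
| "hermite_polynomial (Suc k) = [:0, 2:] * hermite_polynomial k - pderiv (hermite_polynomial k)"

lemma iterated_deriv_gaussian:
  "(deriv ^^ k) (\<lambda>u::real. exp (- (u\<^sup>2))) = (\<lambda>u. (-1) ^ k * poly (hermite_polynomial k) u * exp (- (u\<^sup>2)))"
proof (induction k)
  case (Suc k)
  have "((\<lambda>u. (-1) ^ k * poly (hermite_polynomial k) u * exp (- (u\<^sup>2))) has_real_derivative
      (-1) ^ Suc k * poly (hermite_polynomial (Suc k)) s * exp (- (s\<^sup>2))) (at s)" for s :: real
    by (auto intro!: derivative_eq_intros simp: algebra_simps)
  then show ?case
    by (auto simp: Suc intro!: DERIV_imp_deriv)
qed simp

lemma hermite_poly_eq_poly: "hermite_poly k s = poly (hermite_polynomial k) s"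
proof -
  have "hermite_poly k s = ((-1) ^ k * (-1) ^ k) * (exp (s\<^sup>2) * exp (- (s\<^sup>2))) * poly (hermite_polynomial k) s"
    unfolding hermite_poly_def iterated_deriv_gaussian by (simp only: mult_ac)
  then show ?thesis
    by (simp flip: power_mult_distrib exp_add)
qed

lemma pderiv_hermite_polynomial_Suc: "pderiv (hermite_polynomial (Suc k)) = smult (2 * real (Suc k)) (hermite_polynomial k)"
proof (induction k)
  case 0
  show ?case by (simp add: pderiv_pCons)
next
  case (Suc k)
  have "pderiv (hermite_polynomial (Suc (Suc k))) = smult 2 (hermite_polynomial (Suc k))
     + [:0, 2:] * pderiv (hermite_polynomial (Suc k)) - pderiv (pderiv (hermite_polynomial (Suc k)))"
    by (simp only: hermite_polynomial.simps(2)[of "Suc k"] pderiv_diff pderiv_mult)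
       (simp add: pderiv_pCons)
  also have "\<dots> = smult 2 (hermite_polynomial (Suc k)) + smult (2 * real (Suc k)) ([:0, 2:] * hermite_polynomial k - pderiv (hermite_polynomial k))"
    by (simp only: Suc pderiv_smult smult_diff_right mult_smult_right)
  also have "\<dots> = smult (2 + 2 * real (Suc k)) (hermite_polynomial (Suc k))"
    by (simp only: hermite_polynomial.simps(2)[symmetric] smult_add_left[symmetric])
  also have "2 + 2 * real (Suc k) = 2 * real (Suc (Suc k))" by simp
  finally show ?case .
qed

text \<open>In \<open>H\<^sub>k\<^sub>+\<^sub>2 = 2 s H\<^sub>k\<^sub>+\<^sub>1 - H\<^sub>k\<^sub>+\<^sub>1'\<close> integration by parts turns the first term into \<open>2 / \<mu>\<close> times
  the integral of \<open>H\<^sub>k\<^sub>+\<^sub>1'\<close>, and \<open>H\<^sub>k\<^sub>+\<^sub>1'\<close> is a multiple of \<open>H\<^sub>k\<close>.\<close>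

lemma hermite_gaussian_integral_step:
  fixes \<mu> :: real
  assumes "\<mu> > 0"
  shows "(LINT s|lborel. poly (hermite_polynomial (Suc (Suc k))) s * exp (- (\<mu> * s\<^sup>2 / 2))) =
    (2 / \<mu> - 1) * (2 * real (Suc k)) * (LINT s|lborel. poly (hermite_polynomial k) s * exp (- (\<mu> * s\<^sup>2 / 2)))"
proof -
  let ?w = "\<lambda>s. exp (- (\<mu> * s\<^sup>2 / 2))"
  let ?H = "hermite_polynomial (Suc k)"
  have der: "(LINT s|lborel. poly (pderiv ?H) s * ?w s)
      = 2 * real (Suc k) * (LINT s|lborel. poly (hermite_polynomial k) s * ?w s)"
    by (simp only: pderiv_hermite_polynomial_Suc poly_smult mult.assoc integral_mult_right_zero)
  have "(LINT s|lborel. poly (hermite_polynomial (Suc (Suc k))) s * ?w s)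
      = (LINT s|lborel. 2 * (poly ([:0,1:] * ?H) s * ?w s) - poly (pderiv ?H) s * ?w s)"
    by (simp only: hermite_polynomial.simps(2)[of "Suc k"]) (simp add: algebra_simps)
  also have "\<dots> = 2 * (LINT s|lborel. poly ([:0,1:] * ?H) s * ?w s)
      - (LINT s|lborel. poly (pderiv ?H) s * ?w s)"
    by (subst Bochner_Integration.integral_diff)
       (use integrable_poly_gaussian[OF assms] in \<open>auto simp del: poly_mult poly_pCons mult_pCons_left hermite_polynomial.simps\<close>)
  also have "(LINT s|lborel. poly ([:0,1:] * ?H) s * ?w s)
      = (LINT s|lborel. poly (pderiv ?H) s * ?w s) / \<mu>"
    using gaussian_integration_by_parts[OF assms, of ?H] assms
    by (simp add: field_simps del: hermite_polynomial.simps)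
  finally show ?thesis
    unfolding der by (simp add: algebra_simps add_divide_distrib del: hermite_polynomial.simps)
qed

lemma hermite_gaussian_integral:
  fixes \<mu> :: real
  assumes "\<mu> > 0"
  shows "(LINT s|lborel. poly (hermite_polynomial (2 * k)) s * exp (- (\<mu> * s\<^sup>2 / 2))) =
    (2 / \<mu> - 1) ^ k * fact (2 * k) / fact k * sqrt (2 * pi / \<mu>)"
proof (induction k)
  case 0
  show ?case using gaussian_moment[OF assms, of 0] by simp
next
  case (Suc k)
  have "(LINT s|lborel. poly (hermite_polynomial (2 * Suc k)) s * exp (- (\<mu> * s\<^sup>2 / 2)))
      = (2 / \<mu> - 1) * (2 * real (Suc (2 * k))) *
        ((2 / \<mu> - 1) ^ k * fact (2 * k) / fact k * sqrt (2 * pi / \<mu>))"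
    using hermite_gaussian_integral_step[OF assms, of "2 * k"] Suc by simp
  moreover have "fact (2 * Suc k) / fact (Suc k) = (2 * real (Suc (2 * k))) * (fact (2 * k) / fact k)"
    by (simp add: divide_simps) (simp add: algebra_simps)
  ultimately show ?case
    by (simp only: times_divide_eq_right[symmetric] power_Suc) (simp only: mult_ac)
qed


section \<open>Gaussians on Euclidean space\<close>

text \<open>Fubini for tensor products: Lebesgue measure on \<open>real ^ 'n\<close> is the image of the product
  measure indexed by the basis vectors, which are matched here with the indices in \<open>'n\<close>.
  Fourier transform and Hermite coefficients of a Gaussian both reduce to the line through it.\<close>

lemma integral_prod_vec:
  fixes \<phi> :: "'n::finite \<Rightarrow> real \<Rightarrow> complex"
  assumes int: "\<And>j. integrable lborel (\<phi> j)"
  shows "integrable lborel (\<lambda>x :: real ^ 'n. \<Prod>j\<in>UNIV. \<phi> j (x $ j))"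
    and "(LINT x|(lborel :: (real ^ 'n) measure). (\<Prod>j\<in>UNIV. \<phi> j (x $ j))) = (\<Prod>j\<in>UNIV. LINT s|lborel. \<phi> j s)"
proof -
  interpret product_sigma_finite "\<lambda>b :: real ^ 'n. lborel :: real measure" by standard
  define ax :: "'n \<Rightarrow> real ^ 'n" where "ax j = axis j 1" for j
  have inj: "inj ax" by (auto simp: inj_def ax_def axis_eq_axis)
  have basis: "Basis = range ax" by (auto simp: Basis_vec_def ax_def)
  define \<psi> where "\<psi> b = \<phi> (inv ax b)" for b
  define T where "T f = (\<Sum>b\<in>Basis. f b *\<^sub>R b)" for f :: "real ^ 'n \<Rightarrow> real"
  have T[measurable]: "T \<in> measurable (\<Pi>\<^sub>M b\<in>Basis. lborel) borel"
    unfolding T_def by measurable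
  have nth: "x $ j = x \<bullet> ax j" for x j by (simp add: ax_def inner_axis)
  have T_nth: "T f $ j = f (ax j)" for f j
    unfolding nth T_def by (rule inner_sum_left_Basis) (simp add: basis)
  have prod: "(\<Prod>j\<in>UNIV. \<phi> j (T f $ j)) = (\<Prod>b\<in>Basis. \<psi> b (f b))" for f
    unfolding basis T_nth by (subst prod.reindex) (use inj in \<open>auto simp: \<psi>_def\<close>)
  have [measurable]: "\<phi> j \<in> borel_measurable borel" for j
    using borel_measurable_integrable[OF int] by simp
  have meas: "(\<lambda>x :: real ^ 'n. \<Prod>j\<in>UNIV. \<phi> j (x $ j)) \<in> borel_measurable borel"
    unfolding nth by measurable
  have lborel: "(lborel :: (real ^ 'n) measure) = distr (\<Pi>\<^sub>M b\<in>Basis. lborel) borel T"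
    unfolding T_def by (rule lborel_eq)
  have int': "integrable lborel (\<psi> b)" for b by (simp add: \<psi>_def int)
  show "integrable lborel (\<lambda>x :: real ^ 'n. \<Prod>j\<in>UNIV. \<phi> j (x $ j))"
    unfolding lborel integrable_distr_eq[OF T meas] prod
    by (intro product_integrable_prod int') simp
  show "(LINT x|(lborel :: (real ^ 'n) measure). (\<Prod>j\<in>UNIV. \<phi> j (x $ j))) = (\<Prod>j\<in>UNIV. LINT s|lborel. \<phi> j s)"
    unfolding lborel integral_distr[OF T meas] prod
    by (subst product_integral_prod)
       (use inj int' in \<open>auto simp: basis prod.reindex \<psi>_def\<close>)
qed

definition gaussian :: "real \<Rightarrow> real ^ 'n \<Rightarrow> complex" where
  "gaussian \<nu> x = complex_of_real (exp (- (\<nu> * (norm x)\<^sup>2 / 2)))"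

lemma gaussian_eq_prod:
  "gaussian \<nu> x = (\<Prod>j\<in>UNIV. complex_of_real (exp (- (\<nu> * (x $ j)\<^sup>2 / 2))))"
proof -
  have "- (\<nu> * (norm x)\<^sup>2 / 2) = (\<Sum>j\<in>UNIV. - (\<nu> * (x $ j)\<^sup>2 / 2))"
    unfolding power2_norm_eq_inner inner_vec_def
    by (simp add: sum_distrib_left sum_divide_distrib sum_negf power2_eq_square)
  then show ?thesis
    by (simp only: gaussian_def exp_sum[OF finite] of_real_prod)
qed

lemma integrable_gaussian:
  assumes "\<nu> > 0"
  shows "integrable lborel (gaussian \<nu>)"
  unfolding gaussian_eq_prod using integrable_monomial_gaussian[OF assms, of 0]
  by (intro integral_prod_vec(1) integrable_of_real) simp

lemma gaussian_in_L2:
  assumes "\<nu> > 0"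
  shows "(\<lambda>x. c * gaussian \<nu> x) \<in> L2"
proof -
  have sq: "(norm (c * gaussian \<nu> x))\<^sup>2 = (norm c)\<^sup>2 * norm (gaussian (2 * \<nu>) x)" for x :: "real ^ 'n"
    by (simp add: gaussian_def norm_mult power_mult_distrib flip: exp_double)
  show ?thesis
    using integrable_gaussian[OF assms] integrable_gaussian[of "2 * \<nu>"] assms
    unfolding L2_def mem_Collect_eq sq
    by (intro conjI borel_measurable_integrable integrable_mult_right integrable_norm) simp_all
qed

text \<open>After rescaling this is the characteristic function of the standard normal distribution.\<close>

lemma fourier_gaussian_1d:
  fixes \<nu> u :: real
  assumes "\<nu> > 0"
  shows "(LINT s|lborel. complex_of_real (exp (- (\<nu> * s\<^sup>2 / 2))) * exp (- (\<i> * complex_of_real (s * u)))) =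
    complex_of_real (sqrt (2 * pi / \<nu>) * exp (- (1 / \<nu> * u\<^sup>2 / 2)))"
proof -
  define c where "c = 1 / sqrt \<nu>"
  have c: "c > 0" "\<nu> * c\<^sup>2 = 1" "c\<^sup>2 = 1 / \<nu>" using assms by (simp_all add: c_def power_divide)
  have eq: "complex_of_real (exp (- (\<nu> * (0 + c * s)\<^sup>2 / 2))) * exp (- (\<i> * complex_of_real ((0 + c * s) * u)))
      = complex_of_real (sqrt (2 * pi)) * (std_normal_density s *\<^sub>R iexp ((- (c * u)) * s))" for s
  proof -
    have "\<nu> * (0 + c * s)\<^sup>2 = s\<^sup>2" using c(2) by (simp add: power_mult_distrib flip: mult.assoc)
    then show ?thesis
      by (simp add: std_normal_density_def scaleR_conv_of_real mult_ac)
  qed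
  have "(LINT s|lborel. std_normal_density s *\<^sub>R iexp ((- (c * u)) * s))
      = char std_normal_distribution (- (c * u))"
    unfolding char_def by (subst integral_density) (auto simp: normal_density_nonneg)
  also have "\<dots> = complex_of_real (exp (- (1 / \<nu> * u\<^sup>2 / 2)))"
    by (simp add: char_std_normal_distribution power_mult_distrib c(3))
  finally have *: "(LINT s|lborel. std_normal_density s *\<^sub>R iexp ((- (c * u)) * s))
      = complex_of_real (exp (- (1 / \<nu> * u\<^sup>2 / 2)))" .
  show ?thesis
    using c(1)
    by (subst lborel_integral_real_affine[OF less_imp_neq[THEN not_sym, OF c(1)], of _ 0],
        unfold eq integral_mult_right_zero *)
       (simp add: scaleR_conv_of_real c_def real_sqrt_divide)
qed

lemma fourier_gaussian:
  fixes \<nu> :: real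
  assumes "\<nu> > 0"
  shows "fourier_L1 (gaussian \<nu> :: real ^ 'n \<Rightarrow> complex) =
    (\<lambda>y. complex_of_real (sqrt (1 / \<nu>) ^ CARD('n)) * gaussian (1 / \<nu>) y)"
proof
  fix y :: "real ^ 'n"
  let ?\<phi> = "\<lambda>j s. complex_of_real (exp (- (\<nu> * s\<^sup>2 / 2))) * exp (- (\<i> * complex_of_real (s * y $ j)))"
  have int: "integrable lborel (?\<phi> j)" for j
  proof -
    have "integrable lborel (\<lambda>s. complex_of_real (exp (- (\<nu> * s\<^sup>2 / 2))))"
      using integrable_monomial_gaussian[OF assms, of 0] by (intro integrable_of_real) simp
    then show ?thesis
      by (rule Bochner_Integration.integrable_bound) (auto simp: norm_mult)
  qed
  have "gaussian \<nu> x * exp (- (\<i> * complex_of_real (x \<bullet> y))) = (\<Prod>j\<in>UNIV. ?\<phi> j (x $ j))" for x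
    unfolding gaussian_eq_prod prod.distrib inner_vec_def
    by (simp add: sum_distrib_left sum_negf flip: exp_sum)
  then have "(LINT x|lborel. gaussian \<nu> x * exp (- (\<i> * complex_of_real (x \<bullet> y)))) =
      (\<Prod>j\<in>UNIV. complex_of_real (sqrt (2 * pi / \<nu>) * exp (- (1 / \<nu> * (y $ j)\<^sup>2 / 2))))"
    using integral_prod_vec(2)[of ?\<phi>, OF int] by (simp only: fourier_gaussian_1d[OF assms])
  also have "\<dots> = complex_of_real (sqrt (2 * pi / \<nu>) ^ CARD('n)) * gaussian (1 / \<nu>) y"
    by (simp only: of_real_mult prod.distrib gaussian_eq_prod[symmetric] prod_constant of_real_power)
  finally have "fourier_L1 (gaussian \<nu>) y =
      complex_of_real ((2 * pi) powr (- (real CARD('n) / 2)) * sqrt (2 * pi / \<nu>) ^ CARD('n)) * gaussian (1 / \<nu>) y"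
    by (simp add: fourier_L1_def)
  also have "(2 * pi) powr (- (real CARD('n) / 2)) = (1 / sqrt (2 * pi)) ^ CARD('n)"
  proof -
    have "(2 * pi) powr (real CARD('n) / 2) = ((2 * pi) powr (1 / 2)) powr real CARD('n)"
      by (simp add: powr_powr)
    also have "\<dots> = sqrt (2 * pi) ^ CARD('n)"
      by (simp only: powr_half_sqrt pi_ge_zero mult_nonneg_nonneg zero_le_numeral) (simp add: powr_realpow)
    finally show ?thesis by (simp add: powr_minus power_divide inverse_eq_divide)
  qed
  also have "(1 / sqrt (2 * pi)) ^ CARD('n) * sqrt (2 * pi / \<nu>) ^ CARD('n) = sqrt (1 / \<nu>) ^ CARD('n)"
    by (simp add: real_sqrt_divide flip: power_mult_distrib)
  finally show "fourier_L1 (gaussian \<nu>) y = complex_of_real (sqrt (1 / \<nu>) ^ CARD('n)) * gaussian (1 / \<nu>) y" .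
qed

lemma is_fourier_L2_gaussian:
  fixes \<nu> :: real
  assumes "\<nu> > 0"
  shows "is_fourier_L2 (gaussian \<nu>) (fourier_L1 (gaussian \<nu> :: real ^ 'n \<Rightarrow> complex))"
proof -
  have "gaussian \<nu> \<in> L2" using gaussian_in_L2[OF assms, of 1] by simp
  moreover have "fourier_L1 (gaussian \<nu> :: real ^ 'n \<Rightarrow> complex) \<in> L2"
    unfolding fourier_gaussian[OF assms] using assms by (intro gaussian_in_L2) simp
  ultimately show ?thesis
    unfolding is_fourier_L2_def L2_tendsto_def
    by (auto intro!: exI[of _ "\<lambda>_. gaussian \<nu>"] integrable_gaussian assms)
qed

text \<open>The weighted arithmetic-geometric mean inequality leaves a factor \<open>1 - a\<close> of both
  Gaussian exponents, so the integrand is dominated by a product of two integrable Gaussians.\<close>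

lemma beurling_integral_gaussian_finite:
  fixes \<nu> a :: real
  assumes "\<nu> > 0" "0 < a" "a < 1"
  shows "beurling_integral a (gaussian \<nu>) (fourier_L1 (gaussian \<nu> :: real ^ 'n \<Rightarrow> complex)) < \<infinity>"
proof -
  define K where "K = sqrt (1 / \<nu>) ^ CARD('n)"
  have K: "K \<ge> 0" using assms by (simp add: K_def)
  define A where "A x = exp (- ((1 - a) * \<nu> * (norm x)\<^sup>2 / 2))" for x :: "real ^ 'n"
  define B where "B y = K * exp (- ((1 - a) * (1 / \<nu>) * (norm y)\<^sup>2 / 2))" for y :: "real ^ 'n"
  have nonneg: "A x \<ge> 0" "B x \<ge> 0" for x using K by (simp_all add: A_def B_def)
  have int_exp: "integrable lborel (\<lambda>x :: real ^ 'n. exp (- (c * (norm x)\<^sup>2 / 2)))" if "c > 0" for c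
    using integrable_norm[OF integrable_gaussian[OF that]] by (simp add: gaussian_def)
  have int: "integrable lborel A" "integrable lborel B"
    unfolding A_def B_def using assms by (intro int_exp integrable_mult_right; simp)+
  have "norm (gaussian \<nu> x) * norm (fourier_L1 (gaussian \<nu>) y) * exp (a * \<bar>x \<bullet> y\<bar>) \<le> A x * B y"
    for x y :: "real ^ 'n"
  proof -
    have "2 * (norm x * norm y) \<le> \<nu> * (norm x)\<^sup>2 + 1 / \<nu> * (norm y)\<^sup>2"
    proof -
      have "0 \<le> (\<nu> * norm x - norm y)\<^sup>2 / \<nu>" using assms by simp
      also have "\<dots> = \<nu> * (norm x)\<^sup>2 + 1 / \<nu> * (norm y)\<^sup>2 - 2 * (norm x * norm y)"
        using assms by (simp add: power2_eq_square field_simps)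
      finally show ?thesis by simp
    qed
    moreover have "\<bar>x \<bullet> y\<bar> \<le> norm x * norm y" by (rule Cauchy_Schwarz_ineq2)
    moreover have "u \<le> w / 2" if "2 * v \<le> w" "u \<le> v" for u v w :: real
      using that by simp
    ultimately have "\<bar>x \<bullet> y\<bar> \<le> (\<nu> * (norm x)\<^sup>2 + 1 / \<nu> * (norm y)\<^sup>2) / 2"
      by blast
    then have "a * \<bar>x \<bullet> y\<bar> \<le> a * ((\<nu> * (norm x)\<^sup>2 + 1 / \<nu> * (norm y)\<^sup>2) / 2)"
      using assms by (intro mult_left_mono) auto
    then have le: "- (\<nu> * (norm x)\<^sup>2 / 2) + - (1 / \<nu> * (norm y)\<^sup>2 / 2) + a * \<bar>x \<bullet> y\<bar>
        \<le> - ((1 - a) * \<nu> * (norm x)\<^sup>2 / 2) + - ((1 - a) * (1 / \<nu>) * (norm y)\<^sup>2 / 2)"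
      by (simp add: algebra_simps add_divide_distrib diff_divide_distrib)
    have "norm (gaussian \<nu> x) * norm (fourier_L1 (gaussian \<nu>) y) * exp (a * \<bar>x \<bullet> y\<bar>)
        = K * exp (- (\<nu> * (norm x)\<^sup>2 / 2) + - (1 / \<nu> * (norm y)\<^sup>2 / 2) + a * \<bar>x \<bullet> y\<bar>)"
      using K unfolding fourier_gaussian[OF assms(1)] K_def[symmetric]
      by (simp only: gaussian_def norm_mult norm_of_real exp_add abs_exp_cancel abs_of_nonneg) (simp only: mult_ac)
    also have "\<dots> \<le> K * exp (- ((1 - a) * \<nu> * (norm x)\<^sup>2 / 2) + - ((1 - a) * (1 / \<nu>) * (norm y)\<^sup>2 / 2))"
      using K le by (intro mult_left_mono) (simp_all only: exp_le_cancel_iff)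
    also have "\<dots> = A x * B y"
      by (simp only: A_def B_def exp_add mult_ac)
    finally show ?thesis .
  qed
  then have "beurling_integral a (gaussian \<nu>) (fourier_L1 (gaussian \<nu> :: real ^ 'n \<Rightarrow> complex))
      \<le> (\<integral>\<^sup>+ x. (\<integral>\<^sup>+ y. ennreal (A x) * ennreal (B y) \<partial>lborel) \<partial>lborel)"
    unfolding beurling_integral_def
    by (intro nn_integral_mono) (simp add: ennreal_leI nonneg flip: ennreal_mult)
  also have "\<dots> = (\<integral>\<^sup>+ x. A x \<partial>lborel) * (\<integral>\<^sup>+ y. B y \<partial>lborel)"
    using int by (simp add: nn_integral_cmult nn_integral_multc borel_measurable_integrable)
  also have "\<dots> < \<infinity>"
    using int by (simp add: nn_integral_eq_integral nonneg ennreal_mult_less_top)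
  finally show ?thesis .
qed

section \<open>Hermite coefficients of Gaussians\<close>

definition gaussian_hermite_coeff :: "real \<Rightarrow> nat \<Rightarrow> real" where
  "gaussian_hermite_coeff \<nu> m = (LINT s|lborel. exp (- (\<nu> * s\<^sup>2 / 2)) * hermite_fun m s)"

lemma gaussian_times_hermite_fun:
  "exp (- (\<nu> * s\<^sup>2 / 2)) * hermite_fun m s =
    (2 ^ m * fact m * sqrt pi) powr (- 1 / 2) * (poly (hermite_polynomial m) s * exp (- ((1 + \<nu>) * s\<^sup>2 / 2)))"
proof -
  have "exp (- ((1 + \<nu>) * s\<^sup>2 / 2)) = exp (- (\<nu> * s\<^sup>2 / 2)) * exp (- (s\<^sup>2) / 2)"
    unfolding exp_add[symmetric] by (simp add: algebra_simps add_divide_distrib)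
  then show ?thesis
    by (simp add: hermite_fun_def hermite_poly_eq_poly)
qed

lemma hermite_coeff_gaussian:
  fixes \<alpha> :: "'n::finite \<Rightarrow> nat"
  assumes "\<nu> > 0"
  shows "hermite_coeff (gaussian \<nu>) \<alpha> = complex_of_real (\<Prod>j\<in>UNIV. gaussian_hermite_coeff \<nu> (\<alpha> j))"
proof -
  let ?\<phi> = "\<lambda>j s. complex_of_real (exp (- (\<nu> * s\<^sup>2 / 2)) * hermite_fun (\<alpha> j) s)"
  have "integrable lborel (?\<phi> j)" for j
    unfolding gaussian_times_hermite_fun using assms
    by (intro integrable_of_real integrable_mult_right integrable_poly_gaussian) simp
  then have "(LINT x|lborel. (\<Prod>j\<in>UNIV. ?\<phi> j (x $ j))) = (\<Prod>j\<in>UNIV. LINT s|lborel. ?\<phi> j s)"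
    by (rule integral_prod_vec(2))
  moreover have "gaussian \<nu> x * complex_of_real (Hermite_Phi \<alpha> x) = (\<Prod>j\<in>UNIV. ?\<phi> j (x $ j))" for x
    unfolding gaussian_eq_prod Hermite_Phi_def by (simp add: prod.distrib)
  ultimately show ?thesis
    by (simp only: hermite_coeff_def integral_complex_of_real gaussian_hermite_coeff_def of_real_prod)
qed

text \<open>Squaring removes the square root in the normalisation of the Hermite functions and
  turns the factorials into a central binomial coefficient, which is \<open>4 ^ k\<close> up to a power
  of \<open>k\<close>: only the geometric factor matters for the decay.\<close>

lemma gaussian_hermite_coeff_sq:
  assumes "\<nu> > 0"
  shows "(gaussian_hermite_coeff \<nu> (2 * k))\<^sup>2 =
    2 * sqrt pi / (1 + \<nu>) * (real ((2 * k) choose k) / 4 ^ k) * ((1 - \<nu>) / (1 + \<nu>)) ^ (2 * k)"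
proof -
  define N where "N = 2 ^ (2 * k) * fact (2 * k) * sqrt pi"
  have N: "N > 0" by (simp add: N_def)
  have N4: "N = 4 ^ k * fact (2 * k) * sqrt pi" by (simp add: N_def power_mult)
  have "(N powr (- 1 / 2))\<^sup>2 = N powr (- 1)"
    by (simp add: power2_eq_square flip: powr_add)
  also have "\<dots> = 1 / N"
    using N by (simp add: powr_minus inverse_eq_divide)
  finally have Nsq: "(N powr (- 1 / 2))\<^sup>2 = 1 / N" .
  have ratio: "2 / (1 + \<nu>) - 1 = (1 - \<nu>) / (1 + \<nu>)"
    using assms by (simp add: field_simps)
  have "gaussian_hermite_coeff \<nu> (2 * k) = N powr (- 1 / 2) *
      (((1 - \<nu>) / (1 + \<nu>)) ^ k * fact (2 * k) / fact k * sqrt (2 * pi / (1 + \<nu>)))"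
    unfolding gaussian_hermite_coeff_def gaussian_times_hermite_fun integral_mult_right_zero
      N_def[symmetric]
    using assms by (subst hermite_gaussian_integral) (simp_all add: ratio)
  then have "(gaussian_hermite_coeff \<nu> (2 * k))\<^sup>2 = 1 / N *
      (((1 - \<nu>) / (1 + \<nu>)) ^ (2 * k) * (fact (2 * k))\<^sup>2 / (fact k)\<^sup>2 * (2 * pi / (1 + \<nu>)))"
    using assms
    by (simp only: power_mult_distrib power_divide Nsq real_sqrt_pow2) (simp add: power_mult power_even_eq mult.commute)
  also have "\<dots> = 2 * (pi / sqrt pi) / (1 + \<nu>) * (fact (2 * k) / (fact k * fact k) / 4 ^ k)
      * ((1 - \<nu>) / (1 + \<nu>)) ^ (2 * k)"
    by (simp add: N4 power2_eq_square[of "fact _"] mult_ac)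
  also have "fact (2 * k) / (fact k * fact k) = real ((2 * k) choose k)"
    using binomial_fact[of k "2 * k", where 'a = real] by simp
  finally show ?thesis
    by (simp add: real_div_sqrt)
qed

lemma gaussian_hermite_coeff_lower_bound:
  assumes "\<nu> > 0" "k > 0"
  shows "2 * sqrt pi / (1 + \<nu>) / (2 * real k) * ((1 - \<nu>) / (1 + \<nu>)) ^ (2 * k)
    \<le> (gaussian_hermite_coeff \<nu> (2 * k))\<^sup>2"
proof -
  have "1 / (2 * real k) \<le> real ((2 * k) choose k) / 4 ^ k"
    using central_binomial_lower_bound[OF assms(2)] assms(2) by (simp add: field_simps)
  then have "2 * sqrt pi / (1 + \<nu>) * (1 / (2 * real k)) * ((1 - \<nu>) / (1 + \<nu>)) ^ (2 * k)
      \<le> 2 * sqrt pi / (1 + \<nu>) * (real ((2 * k) choose k) / 4 ^ k) * ((1 - \<nu>) / (1 + \<nu>)) ^ (2 * k)"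
    using assms by (intro mult_right_mono mult_left_mono) (auto simp: power_mult)
  then show ?thesis
    using assms by (simp add: gaussian_hermite_coeff_sq)
qed

section \<open>No uniform decay rate\<close>

theorem theorem2p8:
  fixes a :: real
  assumes "0 < a" and "a < 1"
  shows "\<not> (\<exists>t::real. t > 0 \<and>
    (\<forall>f g :: real ^ 'n \<Rightarrow> complex.
       f \<in> L2 \<and> is_fourier_L2 f g \<and> beurling_integral a f g < \<infinity> \<longrightarrow>
       (\<exists>C::real. \<forall>\<alpha>::'n \<Rightarrow> nat.
          norm (hermite_coeff f \<alpha>)
            \<le> C * exp (- ((2 * real (multi_deg \<alpha>) + real CARD('n)) * t / 2)))))"
proof (rule notI, elim exE conjE)
  fix t :: real
  assume t: "t > 0"
  assume decay: "\<forall>f g :: real ^ 'n \<Rightarrow> complex.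
       f \<in> L2 \<and> is_fourier_L2 f g \<and> beurling_integral a f g < \<infinity> \<longrightarrow>
       (\<exists>C::real. \<forall>\<alpha>::'n \<Rightarrow> nat.
          norm (hermite_coeff f \<alpha>)
            \<le> C * exp (- ((2 * real (multi_deg \<alpha>) + real CARD('n)) * t / 2)))"
  \<comment> \<open>This is \<open>tanh (t / 2)\<close>, the solution of \<open>(1 - \<nu>) / (1 + \<nu>) = exp (- t)\<close>.\<close>
  define \<nu> where "\<nu> = (1 - exp (- t)) / (1 + exp (- t))"
  have den: "1 + exp (- t) > 0" by (simp add: add_pos_pos)
  have \<nu>: "\<nu> > 0" using t den by (simp add: \<nu>_def)
  have ratio: "(1 - \<nu>) / (1 + \<nu>) = exp (- t)"
    using den by (simp add: \<nu>_def field_simps)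
  let ?f = "gaussian \<nu> :: real ^ 'n \<Rightarrow> complex"
  have "?f \<in> L2 \<and> is_fourier_L2 ?f (fourier_L1 ?f) \<and> beurling_integral a ?f (fourier_L1 ?f) < \<infinity>"
    using gaussian_in_L2[OF \<nu>, of 1] is_fourier_L2_gaussian[OF \<nu>]
      beurling_integral_gaussian_finite[OF \<nu> assms] by simp
  then obtain C where C: "norm (hermite_coeff ?f \<alpha>)
      \<le> C * exp (- ((2 * real (multi_deg \<alpha>) + real CARD('n)) * t / 2))" for \<alpha> :: "'n \<Rightarrow> nat"
    using decay by blast
  define K where "K = 2 * sqrt pi / (1 + \<nu>)"
  have K: "K > 0" using \<nu> by (simp add: K_def)
  \<comment> \<open>Compare both sides at the multi-index with all entries \<open>2 k\<close>, where the coefficient is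
    an \<open>n\<close>-th power. After squaring, the lower bound decays like \<open>exp (- 2 k t)\<close> per coordinate
    and the claimed upper bound like \<open>exp (- 4 k t)\<close>.\<close>
  have bound: "(K / (2 * real k) * exp (2 * real k * t)) ^ CARD('n) \<le> C\<^sup>2" if "k > 0" for k
  proof -
    let ?c = "gaussian_hermite_coeff \<nu> (2 * k)"
    let ?E = "exp (- (2 * real k * t))"
    have "\<bar>?c\<bar> ^ CARD('n) = norm (hermite_coeff ?f (\<lambda>_. 2 * k))"
      by (simp add: hermite_coeff_gaussian[OF \<nu>] power_abs del: of_real_power)
    also have "\<dots> \<le> C * exp (- ((2 * real (multi_deg (\<lambda>_ :: 'n. 2 * k)) + real CARD('n)) * t / 2))"
      by (rule C)
    also have "\<dots> = C * exp (- ((4 * real k + 1) * t / 2)) ^ CARD('n)"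
      by (simp add: multi_deg_def algebra_simps flip: exp_of_nat_mult)
    finally have "(\<bar>?c\<bar> ^ CARD('n))\<^sup>2 \<le> (C * exp (- ((4 * real k + 1) * t / 2)) ^ CARD('n))\<^sup>2"
      by (intro power_mono) simp_all
    moreover have "(x ^ m)\<^sup>2 = (x\<^sup>2) ^ m" for x :: real and m
      by (metis mult.commute power_mult)
    ultimately have "(?c\<^sup>2) ^ CARD('n) \<le> C\<^sup>2 * ((exp (- ((4 * real k + 1) * t / 2)))\<^sup>2) ^ CARD('n)"
      by (simp only: power_mult_distrib power2_abs)
    also have "\<dots> \<le> C\<^sup>2 * (?E * ?E) ^ CARD('n)"
    proof (intro mult_left_mono power_mono)
      show "(exp (- ((4 * real k + 1) * t / 2)))\<^sup>2 \<le> ?E * ?E"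
        using t by (simp add: algebra_simps flip: exp_double exp_add)
    qed simp_all
    finally have upper: "(?c\<^sup>2) ^ CARD('n) \<le> C\<^sup>2 * (?E * ?E) ^ CARD('n)" .
    have split: "K / (2 * real k) * ?E = K / (2 * real k) * exp (2 * real k * t) * (?E * ?E)"
      by (simp add: exp_minus)
    have "exp (- t) ^ (2 * k) = ?E" by (simp flip: exp_of_nat_mult)
    then have "K / (2 * real k) * ?E \<le> ?c\<^sup>2"
      using gaussian_hermite_coeff_lower_bound[OF \<nu> that] by (simp add: ratio K_def)
    then have "(K / (2 * real k) * ?E) ^ CARD('n) \<le> (?c\<^sup>2) ^ CARD('n)"
      using K by (intro power_mono) auto
    also note upper
    finally have "(K / (2 * real k) * exp (2 * real k * t)) ^ CARD('n) * (?E * ?E) ^ CARD('n) \<le> C\<^sup>2 * (?E * ?E) ^ CARD('n)"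
      by (simp only: split power_mult_distrib)
    then show ?thesis by simp
  qed
  have "filterlim (\<lambda>k. K / (2 * real k) * exp (2 * real k * t)) at_top sequentially"
    using K t by real_asymp
  then have "eventually (\<lambda>k. K / (2 * real k) * exp (2 * real k * t) \<ge> C\<^sup>2 + 1 \<and> k > 0) sequentially"
    by (intro eventually_conj eventually_gt_at_top) (simp add: filterlim_at_top)
  then obtain k where k: "K / (2 * real k) * exp (2 * real k * t) \<ge> C\<^sup>2 + 1" "k > 0"
    by (auto dest: eventually_happens)
  have "C\<^sup>2 + 1 \<le> (C\<^sup>2 + 1) ^ CARD('n)"
    by (rule self_le_power) auto
  also have "\<dots> \<le> (K / (2 * real k) * exp (2 * real k * t)) ^ CARD('n)"
    using k(1) by (rule power_mono) simp
  also have "\<dots> \<le> C\<^sup>2"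
    using k(2) by (rule bound)
  finally show False by simp
qed

end
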